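(* Let $D\ge 1$ and let $a_1,\dots,a_D,c_1,\dots,c_D$ be positive real constants with $a_d\ne c_d$ for each $d$ and $\sum_{d=1}^D(a_d+c_d)\le 1$. Let $W^{(D)}$ be the weight matrix associated with the $N_1\times N_2\times\cdots\times N_D$ lattice with weights $W_{i,i^{d+}}=c_d$ and $W_{i,i^{d-}}=a_d$, $d=1,\dots,D$. For each $d$ let $W^{(1)}_d$ be the $N_d\times N_d$ weight matrix associated with the $1$-dimensional lattice of $N_d$ nodes with weights $W^{(1)}_d(i,i+1)=c_d$, $W^{(1)}_d(i+1,i)=a_d$, $i\in\{1,\dots,N_d-1\}$, and let $\lambda_{1}(W^{(1)}_d),\dots,\lambda_{N_d}(W^{(1)}_d)$ be its eigenvalues. Then the eigenvalues of $W^{(D)}$ are $$\lambda_{\vec\ell}\,(W^{(D)})=1-\sum_{d=1}^D\bigl(1-\lambda_{\ell_d}(W^{(1)}_d)\bigr),\qquad \vec\ell=(\ell_1,\dots,\ell_D),\ \ \ell_d\in\{1,\dots,N_d\},$$ and the left Perron vector of $W^{(D)}$ is $$\pi=\pi^{(1)}_D\otimes\pi^{(1)}_{D-1}\otimes\cdots\otimes\pi^{(1)}_1,$$ where $\pi^{(1)}_d$ is the left Perron vector of $W^{(1)}_d$ and $\otimes$ is the Kronecker product.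
   Context: An $N_1\times\cdots\times N_D$ ($D$-dimensional) lattice is the graph with $N=N_1N_2\cdots N_D$ nodes placed at the integer points of a box with side lengths $N_1,\dots,N_D$ (in nodes) in $\mathbb{R}^D$ with Cartesian axes $x_1,\dots,x_D$, where each node is connected (in both directions) to exactly the nodes at distance one from it. For a node $i$, $i^{d+}$ (resp. $i^{d-}$) denotes its neighbor in the positive (resp. negative) $x_d$ direction, when that neighbor exists. Nodes are numbered $1,\dots,N$ with the $x_1$-coordinate varying fastest, then $x_2$, and so on (e.g. in a $2$-dimensional lattice with $N_1=3$, one has $2^{1+}=3$, $2^{1-}=1$, $2^{2+}=5$). A weight matrix associated with a lattice with prescribed weights is the matrix with the prescribed off-diagonal entries for existing neighbors, all other off-diagonal entries $0$, and diagonal entries $W_{i,i}=1-\sum_{j\neq i}W_{i,j}$, so that it is (row) stochastic: $W\mathbf 1=\mathbf 1$ with $\mathbf 1$ the all-ones vector. The $1$-dimensional lattice of $N_d$ nodes is the path $1,2,\dots,N_d$. The left Perron vector of a stochastic, irreducible, primitive matrix $W$ is the row vector $\pi$ with $\pi W=\pi$, all entries positive, and entries summing to $1$. Eigenvalues are listed with multiplicity. *)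

theory Defs
  imports
    Complex_Main
    "HOL-Library.FuncSet"
    "HOL-Library.Multiset"
    "Jordan_Normal_Form.Char_Poly"
begin

text \<open>Nodes, coordinates and dimensions are numbered from 0. The coordinates of a node are its
  mixed-radix digits, with coordinate 0 varying fastest; see \<open>lattice_coord_number\<close> below.\<close>

definition num_nodes :: "nat \<Rightarrow> (nat \<Rightarrow> nat) \<Rightarrow> nat" where
  "num_nodes D N = (\<Prod>d<D. N d)"

definition lattice_coord :: "(nat \<Rightarrow> nat) \<Rightarrow> nat \<Rightarrow> nat \<Rightarrow> nat" where
  "lattice_coord N i d = (i div (\<Prod>e<d. N e)) mod N d"

definition lattice_dist :: "nat \<Rightarrow> (nat \<Rightarrow> nat) \<Rightarrow> nat \<Rightarrow> nat \<Rightarrow> real" where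
  "lattice_dist D N i j =
     sqrt (\<Sum>d<D. (real (lattice_coord N i d) - real (lattice_coord N j d))\<^sup>2)"

definition lattice_adj :: "nat \<Rightarrow> (nat \<Rightarrow> nat) \<Rightarrow> nat \<Rightarrow> nat \<Rightarrow> bool" where
  "lattice_adj D N i j \<longleftrightarrow>
     i < num_nodes D N \<and> j < num_nodes D N \<and> lattice_dist D N i j = 1"

text \<open>\<open>j\<close> is the neighbor of \<open>i\<close> in the positive, respectively negative, direction of axis \<open>d\<close>.\<close>

definition pos_neighbor :: "nat \<Rightarrow> (nat \<Rightarrow> nat) \<Rightarrow> nat \<Rightarrow> nat \<Rightarrow> nat \<Rightarrow> bool" where
  "pos_neighbor D N d i j \<longleftrightarrow> lattice_adj D N i j \<and> lattice_coord N j d > lattice_coord N i d"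

definition neg_neighbor :: "nat \<Rightarrow> (nat \<Rightarrow> nat) \<Rightarrow> nat \<Rightarrow> nat \<Rightarrow> nat \<Rightarrow> bool" where
  "neg_neighbor D N d i j \<longleftrightarrow> lattice_adj D N i j \<and> lattice_coord N j d < lattice_coord N i d"

definition weight_mat :: "nat \<Rightarrow> (nat \<Rightarrow> nat \<Rightarrow> real) \<Rightarrow> real mat" where
  "weight_mat n w =
     mat n n (\<lambda>(i, j). if i = j then 1 - (\<Sum>k\<in>{..<n} - {i}. w i k) else w i j)"

text \<open>For given nodes at most one term of this sum is present; the lemmas
  \<open>lattice_weight_pos\<close>, \<open>lattice_weight_neg\<close> and \<open>lattice_weight_0\<close> confirm its values.\<close>

definition lattice_weight ::
  "nat \<Rightarrow> (nat \<Rightarrow> nat) \<Rightarrow> (nat \<Rightarrow> real) \<Rightarrow> (nat \<Rightarrow> real) \<Rightarrow> nat \<Rightarrow> nat \<Rightarrow> real" where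
  "lattice_weight D N a c i j =
     (\<Sum>d<D. if pos_neighbor D N d i j then c d
             else if neg_neighbor D N d i j then a d else 0)"

definition lattice_mat ::
  "nat \<Rightarrow> (nat \<Rightarrow> nat) \<Rightarrow> (nat \<Rightarrow> real) \<Rightarrow> (nat \<Rightarrow> real) \<Rightarrow> real mat" where
  "lattice_mat D N a c = weight_mat (num_nodes D N) (lattice_weight D N a c)"

definition path_mat :: "nat \<Rightarrow> real \<Rightarrow> real \<Rightarrow> real mat" where
  "path_mat n a c =
     weight_mat n (\<lambda>i j. if j = i + 1 then c else if i = j + 1 then a else 0)"

text \<open>Complex eigenvalues with algebraic multiplicity.\<close>

definition eigvals :: "real mat \<Rightarrow> complex multiset" where
  "eigvals A = proots (char_poly (map_mat complex_of_real A))"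

definition stochastic_mat :: "real mat \<Rightarrow> bool" where
  "stochastic_mat A \<longleftrightarrow> square_mat A \<and>
     (\<forall>i<dim_row A. \<forall>j<dim_row A. A $$ (i, j) \<ge> 0) \<and>
     A *\<^sub>v vec (dim_row A) (\<lambda>_. 1) = vec (dim_row A) (\<lambda>_. 1)"

text \<open>Irreducibility: the directed graph of the nonzero entries is strongly connected.\<close>

definition irreducible_mat :: "real mat \<Rightarrow> bool" where
  "irreducible_mat A \<longleftrightarrow> (\<forall>i<dim_row A. \<forall>j<dim_row A.
     (i, j) \<in> {(k, l). k < dim_row A \<and> l < dim_row A \<and> A $$ (k, l) \<noteq> 0}\<^sup>*)"

definition primitive_mat :: "real mat \<Rightarrow> bool" where
  "primitive_mat A \<longleftrightarrow>
     (\<exists>m>0. \<forall>i<dim_row A. \<forall>j<dim_row A. (A ^\<^sub>m m) $$ (i, j) > 0)"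

text \<open>The row vector \<open>\<pi>\<close> is represented by a vector, and \<open>\<pi> W\<close> by \<open>W\<^sup>T *\<^sub>v \<pi>\<close>.\<close>

definition is_left_Perron_vec :: "real mat \<Rightarrow> real vec \<Rightarrow> bool" where
  "is_left_Perron_vec W p \<longleftrightarrow>
     stochastic_mat W \<and> irreducible_mat W \<and> primitive_mat W \<and>
     p \<in> carrier_vec (dim_row W) \<and> transpose_mat W *\<^sub>v p = p \<and>
     (\<forall>i<dim_row W. p $ i > 0) \<and> (\<Sum>i<dim_row W. p $ i) = 1"

definition left_Perron_vec :: "real mat \<Rightarrow> real vec" where
  "left_Perron_vec W = (THE p. is_left_Perron_vec W p)"

definition kron_vec :: "real vec \<Rightarrow> real vec \<Rightarrow> real vec"  (infixr "\<otimes>\<^sub>v" 70) where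
  "u \<otimes>\<^sub>v v = vec (dim_vec u * dim_vec v) (\<lambda>i. u $ (i div dim_vec v) * v $ (i mod dim_vec v))"

text \<open>For \<open>D \<ge> 1\<close> this is \<open>p (D - 1) \<otimes>\<^sub>v \<dots> \<otimes>\<^sub>v p 1 \<otimes>\<^sub>v p 0\<close>.\<close>

definition kron_vecs :: "nat \<Rightarrow> (nat \<Rightarrow> real vec) \<Rightarrow> real vec" where
  "kron_vecs D p = foldr (\<lambda>d v. p d \<otimes>\<^sub>v v) (rev [1..<D]) (p 0)"

lemma kron_vecs_3: "kron_vecs 3 p = p 2 \<otimes>\<^sub>v p 1 \<otimes>\<^sub>v p 0"
  by (simp add: kron_vecs_def numeral_eq_Suc)

lemma lattice_number_less:
  assumes "\<And>d. d < D \<Longrightarrow> x d < N d"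
  shows "(\<Sum>d<D. x d * (\<Prod>e<d. N e)) < num_nodes D N"
  using assms
proof (induction D)
  case (Suc D)
  have "(\<Sum>d<Suc D. x d * (\<Prod>e<d. N e)) < (x D + 1) * (\<Prod>e<D. N e)"
    using Suc by (simp add: num_nodes_def)
  also have "\<dots> \<le> N D * (\<Prod>e<D. N e)"
    using Suc.prems[of D] by (intro mult_right_mono) auto
  finally show ?case by (simp add: num_nodes_def mult.commute)
qed (simp add: num_nodes_def)

lemma lattice_coord_number:
  assumes "\<And>d. d < D \<Longrightarrow> x d < N d" and "d < D"
  shows "lattice_coord N (\<Sum>d<D. x d * (\<Prod>e<d. N e)) d = x d"
proof -
  define P where "P k = (\<Prod>e<k. N e)" for k
  have dvd: "P (Suc d) dvd P k" if "d < k" for k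
    unfolding P_def using that by (intro prod_dvd_prod_subset) auto
  have "(\<Sum>k\<in>{d<..<D}. x k * P k) = P (Suc d) * (\<Sum>k\<in>{d<..<D}. x k * (P k div P (Suc d)))"
    unfolding sum_distrib_left using dvd by (intro sum.cong) auto
  then obtain q where q: "(\<Sum>k\<in>{d<..<D}. x k * P k) = P d * (N d * q)"
    by (auto simp: P_def mult.assoc)
  have low: "(\<Sum>k<d. x k * P k) < P d"
    using lattice_number_less[of d x N] assms by (auto simp: P_def num_nodes_def)
  have "{..<D} = {..<d} \<union> {d} \<union> {d<..<D}" using assms(2) by auto
  hence "(\<Sum>k<D. x k * P k) = (\<Sum>k\<in>{..<d} \<union> {d} \<union> {d<..<D}. x k * P k)" by simp
  also have "\<dots> = (\<Sum>k<d. x k * P k) + x d * P d + (\<Sum>k\<in>{d<..<D}. x k * P k)"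
    by (subst sum.union_disjoint; force)+
  also have "\<dots> = (\<Sum>k<d. x k * P k) + P d * (x d + N d * q)"
    unfolding q by (simp add: algebra_simps)
  finally have "(\<Sum>k<D. x k * P k) div P d = x d + N d * q"
    using low by simp
  thus ?thesis using assms by (simp add: lattice_coord_def P_def)
qed

lemma lattice_adj_iff:
  "lattice_adj D N i j \<longleftrightarrow> i < num_nodes D N \<and> j < num_nodes D N \<and>
    (\<exists>d<D. (lattice_coord N j d = lattice_coord N i d + 1 \<or>
            lattice_coord N i d = lattice_coord N j d + 1) \<and>
           (\<forall>e<D. e \<noteq> d \<longrightarrow> lattice_coord N j e = lattice_coord N i e))"
proof -
  define f where "f d = (int (lattice_coord N i d) - int (lattice_coord N j d))\<^sup>2" for d
  have "lattice_dist D N i j = 1 \<longleftrightarrow> (\<Sum>d<D. f d) = 1"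
  proof -
    have "(\<Sum>d<D. (real (lattice_coord N i d) - real (lattice_coord N j d))\<^sup>2)
        = of_int (\<Sum>d<D. f d)"
      by (simp add: f_def)
    thus ?thesis unfolding lattice_dist_def real_sqrt_eq_1_iff by (metis of_int_eq_1_iff)
  qed
  also have "\<dots> \<longleftrightarrow> (\<exists>d<D. f d = 1 \<and> (\<forall>e<D. e \<noteq> d \<longrightarrow> f e = 0))"
  proof
    assume s: "(\<Sum>d<D. f d) = 1"
    then obtain d where d: "d < D" "f d \<noteq> 0" by (metis lessThan_iff sum.neutral zero_neq_one)
    have split: "(\<Sum>d<D. f d) = f d + (\<Sum>e\<in>{..<D} - {d}. f e)"
      using d by (simp add: sum.remove)
    have nn: "f e \<ge> 0" for e by (simp add: f_def)
    have nn2: "(\<Sum>e\<in>{..<D} - {d}. f e) \<ge> 0" using nn by (intro sum_nonneg)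
    have "f d \<ge> 1" using d nn[of d] by linarith
    hence 1: "f d = 1" "(\<Sum>e\<in>{..<D} - {d}. f e) = 0" using s split nn2 by linarith+
    have "\<forall>e\<in>{..<D} - {d}. f e = 0" using 1(2) nn by (subst (asm) sum_nonneg_eq_0_iff) auto
    thus "\<exists>d<D. f d = 1 \<and> (\<forall>e<D. e \<noteq> d \<longrightarrow> f e = 0)" using d 1 by blast
  next
    assume "\<exists>d<D. f d = 1 \<and> (\<forall>e<D. e \<noteq> d \<longrightarrow> f e = 0)"
    then obtain d where "d < D" "f d = 1" "\<forall>e<D. e \<noteq> d \<longrightarrow> f e = 0" by blast
    thus "(\<Sum>d<D. f d) = 1" by (simp add: sum.remove[of _ d])
  qed
  also have "\<dots> \<longleftrightarrow> (\<exists>d<D. (lattice_coord N j d = lattice_coord N i d + 1 \<or>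
            lattice_coord N i d = lattice_coord N j d + 1) \<and>
           (\<forall>e<D. e \<noteq> d \<longrightarrow> lattice_coord N j e = lattice_coord N i e))"
    unfolding f_def power2_eq_1_iff by (intro ex_cong1 conj_cong refl) auto
  finally show ?thesis by (simp add: lattice_adj_def)
qed

lemma lattice_weight_pos:
  assumes "d < D" "pos_neighbor D N d i j"
  shows "lattice_weight D N a c i j = c d"
proof -
  have "lattice_coord N j e = lattice_coord N i e" if "e < D" "e \<noteq> d" for e
    using assms that unfolding pos_neighbor_def lattice_adj_iff by (metis less_irrefl)
  hence "lattice_weight D N a c i j = (\<Sum>e<D. if e = d then c d else 0)"
    unfolding lattice_weight_def using assms
    by (intro sum.cong) (auto simp: pos_neighbor_def neg_neighbor_def)
  thus ?thesis using assms by simp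
qed

lemma lattice_weight_neg:
  assumes "d < D" "neg_neighbor D N d i j"
  shows "lattice_weight D N a c i j = a d"
proof -
  have "lattice_coord N j e = lattice_coord N i e" if "e < D" "e \<noteq> d" for e
    using assms that unfolding neg_neighbor_def lattice_adj_iff by (metis less_irrefl)
  hence "lattice_weight D N a c i j = (\<Sum>e<D. if e = d then a d else 0)"
    unfolding lattice_weight_def using assms
    by (intro sum.cong) (auto simp: pos_neighbor_def neg_neighbor_def)
  thus ?thesis using assms by simp
qed

lemma lattice_weight_0:
  assumes "\<not> lattice_adj D N i j"
  shows "lattice_weight D N a c i j = 0"
  using assms by (simp add: lattice_weight_def pos_neighbor_def neg_neighbor_def)

end

theory Submission
  imports Defs "Jordan_Normal_Form.Schur_Decomposition"
begin

text \<open>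
  A step of the walk on the \<open>(D + 1)\<close>-dimensional lattice changes either the top coordinate, as the
  path in direction \<open>D\<close> does, or the remaining ones, as the \<open>D\<close>-dimensional lattice does. Since the
  top coordinate is the leading digit of a node number, this reads \<open>W' = A \<otimes> I + I \<otimes> W - I\<close> for
  the lattice matrices \<open>W'\<close> and \<open>W\<close> and the path matrix \<open>A\<close> (\<open>lattice_mat_Suc\<close>): the off-diagonal
  entries agree by inspection of the coordinates, and the diagonals agree because both sides have
  row sums 1.
  Everything follows by induction on the dimension from properties of
  \<open>A \<boxplus> B = A \<otimes> I + I \<otimes> B - I\<close>.

  Eigenvalues: if \<open>A = P S P\<^sup>-\<^sup>1\<close> and \<open>B = Q T Q\<^sup>-\<^sup>1\<close> are complex Schur triangularisations, then \<open>P \<otimes> Q\<close>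
  conjugates \<open>A \<boxplus> B\<close> to the upper triangular matrix \<open>S \<boxplus> T\<close>, whose diagonal entries are the numbers
  \<open>s + t - 1 = 1 - ((1 - s) + (1 - t))\<close>. As the diagonal of a Schur form can be arranged in any
  order, the eigenvalues of the lattice come out indexed by its nodes (\<open>eigvals_lattice_mat_by_node\<close>);
  passing from a node to its coordinates gives the index vectors of the theorem.

  Perron vectors: if \<open>p A = p\<close> and \<open>q B = q\<close> then \<open>p \<otimes> q\<close> is fixed by each of the three terms of
  \<open>A \<boxplus> B\<close>, hence by \<open>A \<boxplus> B\<close> itself. For a path the vector exists by detailed
  balance, \<open>p\<^sub>i\<close> being proportional to \<open>(c / a)\<^sup>i\<close>, and irreducibility makes it unique
  (\<open>left_Perron_vec_unique\<close>). Primitivity comes from irreducibility together with a positive diagonal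
  entry; at the corner node \<open>0\<close>, which has no negative neighbors, the diagonal entry is at least
  \<open>1 - \<Sum>\<^sub>d c\<^sub>d \<ge> \<Sum>\<^sub>d a\<^sub>d > 0\<close>.
\<close>

section \<open>Kronecker products of matrices\<close>

lemma digits_less:
  fixes i :: nat
  assumes "i < n * m"
  shows "i div m < n" "i mod m < m"
proof -
  show "i div m < n" using assms by (simp add: less_mult_imp_div_less)
  have "m > 0" using assms by (cases m) auto
  thus "i mod m < m" by simp
qed

lemma number_less:
  fixes k l :: nat
  assumes "k < n" "l < m"
  shows "k * m + l < n * m"
proof -
  have "k * m + l < Suc k * m" using assms by simp
  also have "\<dots> \<le> n * m" using assms by (intro mult_right_mono) auto
  finally show ?thesis .
qed

lemma digits_eq_iff:
  fixes i j m :: nat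
  shows "i div m = j div m \<and> i mod m = j mod m \<longleftrightarrow> i = j"
  by (metis div_mult_mod_eq)

text \<open>An index \<open>t\<close> of a Kronecker product is the pair of digits \<open>(t div l, t mod l)\<close>, so a sum over its
  indices is a double sum; this is how every product below is split into its two factors.\<close>

lemma sum_digits:
  fixes k l :: nat
  shows "(\<Sum>t<k * l. f (t div l) (t mod l)) = (\<Sum>u<k. \<Sum>v<l. f u v)"
  unfolding sum.cartesian_product
  by (rule sum.reindex_bij_witness[of _ "\<lambda>(u, v). u * l + v" "\<lambda>t. (t div l, t mod l)"])
     (auto simp: digits_less number_less)

definition kron_mat :: "'a::comm_ring_1 mat \<Rightarrow> 'a mat \<Rightarrow> 'a mat" where
  "kron_mat A B = mat (dim_row A * dim_row B) (dim_col A * dim_col B)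
     (\<lambda>(i, j). A $$ (i div dim_row B, j div dim_col B) * B $$ (i mod dim_row B, j mod dim_col B))"

lemma kron_mat_carrier [simp]:
  "A \<in> carrier_mat n k \<Longrightarrow> B \<in> carrier_mat m l \<Longrightarrow> kron_mat A B \<in> carrier_mat (n * m) (k * l)"
  by (auto simp: kron_mat_def)

lemma kron_mat_index:
  assumes "A \<in> carrier_mat n k" "B \<in> carrier_mat m l" "i < n * m" "j < k * l"
  shows "kron_mat A B $$ (i, j) = A $$ (i div m, j div l) * B $$ (i mod m, j mod l)"
  using assms by (auto simp: kron_mat_def)

lemma kron_mat_one: "kron_mat (1\<^sub>m n) (1\<^sub>m m) = 1\<^sub>m (n * m)"
proof (rule eq_matI)
  fix i j assume "i < dim_row (1\<^sub>m (n * m))" "j < dim_col (1\<^sub>m (n * m))"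
  then show "kron_mat (1\<^sub>m n) (1\<^sub>m m) $$ (i, j) = 1\<^sub>m (n * m) $$ (i, j)"
    using digits_eq_iff[of i m j]
    by (auto simp: kron_mat_index[where n = n and k = n and m = m and l = m] digits_less)
qed (auto simp: kron_mat_def)

lemma kron_mat_mult:
  assumes A: "A \<in> carrier_mat n k" and B: "B \<in> carrier_mat m l"
    and C: "C \<in> carrier_mat k r" and E: "E \<in> carrier_mat l s"
  shows "kron_mat A B * kron_mat C E = kron_mat (A * C) (B * E)"
proof (rule eq_matI)
  fix i j assume "i < dim_row (kron_mat (A * C) (B * E))" "j < dim_col (kron_mat (A * C) (B * E))"
  hence i: "i < n * m" and j: "j < r * s" using A B C E by (auto simp: kron_mat_def)
  note d = digits_less[OF i] digits_less[OF j]
  have "(kron_mat A B * kron_mat C E) $$ (i, j) =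
      (\<Sum>t<k * l. kron_mat A B $$ (i, t) * kron_mat C E $$ (t, j))"
    using i j carrier_matD[OF kron_mat_carrier[OF A B]] carrier_matD[OF kron_mat_carrier[OF C E]]
    by (simp add: scalar_prod_def atLeast0LessThan)
  also have "\<dots> = (\<Sum>t<k * l. (A $$ (i div m, t div l) * B $$ (i mod m, t mod l)) *
      (C $$ (t div l, j div s) * E $$ (t mod l, j mod s)))"
    by (intro sum.cong) (auto simp: kron_mat_index[OF A B i] kron_mat_index[OF C E _ j])
  also have "\<dots> = (\<Sum>u<k. \<Sum>v<l. (A $$ (i div m, u) * B $$ (i mod m, v)) *
      (C $$ (u, j div s) * E $$ (v, j mod s)))"
    by (rule sum_digits)
  also have "\<dots> = (\<Sum>u<k. A $$ (i div m, u) * C $$ (u, j div s)) *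
      (\<Sum>v<l. B $$ (i mod m, v) * E $$ (v, j mod s))"
    by (simp add: sum_product mult_ac)
  also have "\<dots> = (A * C) $$ (i div m, j div s) * (B * E) $$ (i mod m, j mod s)"
    using A B C E d by (simp add: scalar_prod_def atLeast0LessThan)
  also have "\<dots> = kron_mat (A * C) (B * E) $$ (i, j)"
    using A B C E i j by (intro kron_mat_index[symmetric]) auto
  finally show "(kron_mat A B * kron_mat C E) $$ (i, j) = kron_mat (A * C) (B * E) $$ (i, j)" .
qed (use A B C E in \<open>auto simp: kron_mat_def\<close>)

text \<open>The vector case is stated for real vectors, the type on which the Kronecker product of
  vectors is defined.\<close>

lemma kron_mat_mult_vec:
  assumes A: "A \<in> carrier_mat n k" and B: "B \<in> carrier_mat m l"
    and u: "u \<in> carrier_vec k" and v: "v \<in> carrier_vec l"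
  shows "kron_mat A B *\<^sub>v (u \<otimes>\<^sub>v v) = (A *\<^sub>v u) \<otimes>\<^sub>v (B *\<^sub>v v)"
proof (rule eq_vecI)
  fix i assume "i < dim_vec ((A *\<^sub>v u) \<otimes>\<^sub>v (B *\<^sub>v v))"
  hence i: "i < n * m" using A B by (simp add: kron_vec_def)
  note d = digits_less[OF i]
  have "(kron_mat A B *\<^sub>v (u \<otimes>\<^sub>v v)) $ i = (\<Sum>t<k * l. kron_mat A B $$ (i, t) * (u \<otimes>\<^sub>v v) $ t)"
    using i u v carrier_matD[OF kron_mat_carrier[OF A B]]
    by (simp add: scalar_prod_def atLeast0LessThan kron_vec_def)
  also have "\<dots> = (\<Sum>t<k * l. (A $$ (i div m, t div l) * B $$ (i mod m, t mod l)) *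
      (u $ (t div l) * v $ (t mod l)))"
    using u v by (intro sum.cong) (auto simp: kron_mat_index[OF A B i] kron_vec_def)
  also have "\<dots> = (\<Sum>x<k. \<Sum>y<l. (A $$ (i div m, x) * B $$ (i mod m, y)) * (u $ x * v $ y))"
    by (rule sum_digits)
  also have "\<dots> = (\<Sum>x<k. A $$ (i div m, x) * u $ x) * (\<Sum>y<l. B $$ (i mod m, y) * v $ y)"
    by (simp add: sum_product mult_ac)
  also have "\<dots> = ((A *\<^sub>v u) \<otimes>\<^sub>v (B *\<^sub>v v)) $ i"
    using A B u v d i by (simp add: scalar_prod_def atLeast0LessThan kron_vec_def)
  finally show "(kron_mat A B *\<^sub>v (u \<otimes>\<^sub>v v)) $ i = ((A *\<^sub>v u) \<otimes>\<^sub>v (B *\<^sub>v v)) $ i" .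
qed (use A B in \<open>auto simp: kron_mat_def kron_vec_def\<close>)

section \<open>Moving in one of two factors\<close>

text \<open>For stochastic \<open>A\<close> and \<open>B\<close>, \<open>1 - A \<boxplus> B\<close> is the Kronecker sum of \<open>1 - A\<close> and \<open>1 - B\<close>, so
  jump rates add up and the row sums stay 1. The identity that is subtracted is written as a Kronecker product so that the mixed-product rule applies to all three
  terms alike.\<close>

definition boxplus :: "'a::comm_ring_1 mat \<Rightarrow> 'a mat \<Rightarrow> 'a mat"  (infixr "\<boxplus>" 65) where
  "A \<boxplus> B = kron_mat A (1\<^sub>m (dim_row B)) + kron_mat (1\<^sub>m (dim_row A)) B
     - kron_mat (1\<^sub>m (dim_row A)) (1\<^sub>m (dim_row B))"

lemma boxplus_carrier [simp]:
  "A \<in> carrier_mat n n \<Longrightarrow> B \<in> carrier_mat m m \<Longrightarrow> A \<boxplus> B \<in> carrier_mat (n * m) (n * m)"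
  by (auto simp: boxplus_def kron_mat_def)

lemma boxplus_index:
  assumes "A \<in> carrier_mat n n" "B \<in> carrier_mat m m" "i < n * m" "j < n * m"
  shows "(A \<boxplus> B) $$ (i, j) = (if i mod m = j mod m then A $$ (i div m, j div m) else 0)
    + (if i div m = j div m then B $$ (i mod m, j mod m) else 0) - (if i = j then 1 else 0)"
proof -
  note d = digits_less[OF assms(3)] digits_less[OF assms(4)]
  have o: "1\<^sub>m n \<in> carrier_mat n n" "1\<^sub>m m \<in> carrier_mat m m" by auto
  have dims: "dim_row A = n" "dim_row B = m" using assms by auto
  have "(A \<boxplus> B) $$ (i, j) = kron_mat A (1\<^sub>m m) $$ (i, j) + kron_mat (1\<^sub>m n) B $$ (i, j)
      - kron_mat (1\<^sub>m n) (1\<^sub>m m) $$ (i, j)"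
    using assms by (simp add: boxplus_def dims kron_mat_def)
  also have "\<dots> = A $$ (i div m, j div m) * (1\<^sub>m m) $$ (i mod m, j mod m)
      + (1\<^sub>m n) $$ (i div m, j div m) * B $$ (i mod m, j mod m) - (1\<^sub>m (n * m)) $$ (i, j)"
    by (simp only: kron_mat_one kron_mat_index[OF assms(1) o(2) assms(3,4)]
        kron_mat_index[OF o(1) assms(2) assms(3,4)])
  finally show ?thesis using assms d by simp
qed

lemma boxplus_index_diag:
  assumes "A \<in> carrier_mat n n" "B \<in> carrier_mat m m" "i < n * m"
  shows "(A \<boxplus> B) $$ (i, i) = A $$ (i div m, i div m) + B $$ (i mod m, i mod m) - 1"
  using boxplus_index[OF assms assms(3)] by simp

lemma boxplus_transpose:
  assumes A: "A \<in> carrier_mat n n" and B: "B \<in> carrier_mat m m"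
  shows "transpose_mat (A \<boxplus> B) = transpose_mat A \<boxplus> transpose_mat B"
proof (rule eq_matI)
  have t: "transpose_mat A \<in> carrier_mat n n" "transpose_mat B \<in> carrier_mat m m"
    using A B by auto
  fix i j assume "i < dim_row (transpose_mat A \<boxplus> transpose_mat B)"
    "j < dim_col (transpose_mat A \<boxplus> transpose_mat B)"
  hence ij: "i < n * m" "j < n * m" using carrier_matD[OF boxplus_carrier[OF t]] by auto
  show "transpose_mat (A \<boxplus> B) $$ (i, j) = (transpose_mat A \<boxplus> transpose_mat B) $$ (i, j)"
    using ij A B digits_less[OF ij(1)] digits_less[OF ij(2)] carrier_matD[OF boxplus_carrier[OF A B]]
    by (auto simp: boxplus_index[OF t ij] boxplus_index[OF A B ij(2,1)])
qed (use A B in \<open>auto simp: boxplus_def kron_mat_def\<close>)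

lemma map_mat_boxplus:
  assumes A: "A \<in> carrier_mat n n" and B: "B \<in> carrier_mat m m"
  shows "map_mat complex_of_real (A \<boxplus> B) = map_mat complex_of_real A \<boxplus> map_mat complex_of_real B"
proof (rule eq_matI)
  have t: "map_mat complex_of_real A \<in> carrier_mat n n" "map_mat complex_of_real B \<in> carrier_mat m m"
    using A B by auto
  fix i j assume "i < dim_row (map_mat complex_of_real A \<boxplus> map_mat complex_of_real B)"
    "j < dim_col (map_mat complex_of_real A \<boxplus> map_mat complex_of_real B)"
  hence ij: "i < n * m" "j < n * m" using carrier_matD[OF boxplus_carrier[OF t]] by auto
  show "map_mat complex_of_real (A \<boxplus> B) $$ (i, j) =
      (map_mat complex_of_real A \<boxplus> map_mat complex_of_real B) $$ (i, j)"
    using ij A B digits_less[OF ij(1)] digits_less[OF ij(2)] carrier_matD[OF boxplus_carrier[OF A B]]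
    by (auto simp: boxplus_index[OF t ij] boxplus_index[OF A B ij])
qed (use A B in \<open>auto simp: boxplus_def kron_mat_def\<close>)

lemma boxplus_fixes_kron_vec:
  assumes A: "A \<in> carrier_mat n n" and B: "B \<in> carrier_mat m m"
    and u: "u \<in> carrier_vec n" "A *\<^sub>v u = u" and v: "v \<in> carrier_vec m" "B *\<^sub>v v = v"
  shows "(A \<boxplus> B) *\<^sub>v (u \<otimes>\<^sub>v v) = u \<otimes>\<^sub>v v"
proof -
  have o: "1\<^sub>m n \<in> carrier_mat n n" "1\<^sub>m m \<in> carrier_mat m m" by auto
  have w: "u \<otimes>\<^sub>v v \<in> carrier_vec (n * m)" using u v by (auto simp: kron_vec_def)
  have dims: "dim_row A = n" "dim_row B = m" using A B by auto
  note k = kron_mat_carrier[OF A o(2)] kron_mat_carrier[OF o(1) B] kron_mat_carrier[OF o]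
  have "(A \<boxplus> B) *\<^sub>v (u \<otimes>\<^sub>v v) = kron_mat A (1\<^sub>m m) *\<^sub>v (u \<otimes>\<^sub>v v)
      + kron_mat (1\<^sub>m n) B *\<^sub>v (u \<otimes>\<^sub>v v) - kron_mat (1\<^sub>m n) (1\<^sub>m m) *\<^sub>v (u \<otimes>\<^sub>v v)"
    unfolding boxplus_def dims
    using minus_mult_distrib_mat_vec[OF add_carrier_mat[OF k(2)] k(3) w]
      add_mult_distrib_mat_vec[OF k(1,2) w] by simp
  also have "\<dots> = u \<otimes>\<^sub>v v + u \<otimes>\<^sub>v v - u \<otimes>\<^sub>v v"
    unfolding kron_mat_mult_vec[OF A o(2) u(1) v(1)] kron_mat_mult_vec[OF o(1) B u(1) v(1)]
      kron_mat_mult_vec[OF o u(1) v(1)] using u v by simp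
  also have "\<dots> = u \<otimes>\<^sub>v v" using w by auto
  finally show ?thesis .
qed

section \<open>Eigenvalues\<close>

text \<open>Conjugation by \<open>P \<otimes> P'\<close> acts on each factor separately and leaves identity factors alone.\<close>

lemma boxplus_similar:
  fixes A B :: "'a::comm_ring_1 mat"
  assumes A: "A \<in> carrier_mat n n" and B: "B \<in> carrier_mat m m"
    and "similar_mat_wit A S P Q" "similar_mat_wit B T P' Q'"
  shows "similar_mat (A \<boxplus> B) (S \<boxplus> T)"
proof -
  note a = similar_mat_witD2[OF A assms(3)] and b = similar_mat_witD2[OF B assms(4)]
  have o: "1\<^sub>m n \<in> carrier_mat n n" "1\<^sub>m m \<in> carrier_mat m m" by auto
  have dims: "dim_row A = n" "dim_row B = m" "dim_row S = n" "dim_row T = m" using a b by auto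
  let ?P = "kron_mat P P'" and ?Q = "kron_mat Q Q'"
  have P: "?P \<in> carrier_mat (n * m) (n * m)" and Q: "?Q \<in> carrier_mat (n * m) (n * m)"
    using a b by auto
  have conj: "?P * kron_mat X Y * ?Q = kron_mat (P * X * Q) (P' * Y * Q')"
    if "X \<in> carrier_mat n n" "Y \<in> carrier_mat m m" for X Y
    using that a b by (simp add: kron_mat_mult[where n = n and k = n and m = m and l = m and r = n and s = m])
  note k = kron_mat_carrier[OF a(5) o(2)] kron_mat_carrier[OF o(1) b(5)] kron_mat_carrier[OF o]
  have "?P * (S \<boxplus> T) * ?Q = ?P * kron_mat S (1\<^sub>m m) * ?Q + ?P * kron_mat (1\<^sub>m n) T * ?Q
      - ?P * kron_mat (1\<^sub>m n) (1\<^sub>m m) * ?Q"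
    unfolding boxplus_def dims
    using mult_minus_distrib_mat[OF P add_carrier_mat[OF k(2)] k(3)] mult_add_distrib_mat[OF P k(1,2)]
      minus_mult_distrib_mat[OF add_carrier_mat[OF mult_carrier_mat[OF P k(2)]]
          mult_carrier_mat[OF P k(3)] Q]
      add_mult_distrib_mat[OF mult_carrier_mat[OF P k(1)] mult_carrier_mat[OF P k(2)] Q]
    by simp
  also have "\<dots> = A \<boxplus> B"
    unfolding boxplus_def dims conj[OF a(5) o(2)] conj[OF o(1) b(5)] conj[OF o]
    using a b by simp
  finally have "A \<boxplus> B = ?P * (S \<boxplus> T) * ?Q" ..
  moreover have "?P * ?Q = 1\<^sub>m (n * m)" "?Q * ?P = 1\<^sub>m (n * m)"
    using a b by (simp_all add: kron_mat_one
      kron_mat_mult[where n = n and k = n and m = m and l = m and r = n and s = m])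
  ultimately show ?thesis
    using P Q boxplus_carrier[OF A B] boxplus_carrier[OF a(5) b(5)]
    by (intro similar_matI[of _ _ ?P ?Q "n * m"]) blast+
qed

text \<open>Node numbers are ordered lexicographically by their digits: where \<open>j < i\<close> and one digit agrees,
  the other digit of \<open>j\<close> is the smaller one.\<close>

lemma boxplus_upper_triangular:
  assumes A: "A \<in> carrier_mat n n" "upper_triangular A" and B: "B \<in> carrier_mat m m" "upper_triangular B"
  shows "upper_triangular (A \<boxplus> B)"
  unfolding upper_triangular_def
proof (intro allI impI)
  fix i j assume "i < dim_row (A \<boxplus> B)" and ji: "j < i"
  hence i: "i < n * m" using carrier_matD[OF boxplus_carrier[OF A(1) B(1)]] by simp
  with ji have j: "j < n * m" by simp
  have "i div m = j div m \<Longrightarrow> j mod m < i mod m"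
    by (metis ji div_mult_mod_eq nat_add_left_cancel_less)
  moreover have "j div m < i div m" if "i mod m = j mod m"
    using that ji digits_eq_iff[of i m j] div_le_mono[of j i m] by fastforce
  ultimately show "(A \<boxplus> B) $$ (i, j) = 0"
    using ji A B digits_less[OF i] by (auto simp: boxplus_index[OF A(1) B(1) i j])
qed

lemma proots_prod_list_linear: "proots (\<Prod>a\<leftarrow>es. [:- a, 1:]) = mset (es :: complex list)"
proof (induction es)
  case (Cons a es)
  have "(\<Prod>a\<leftarrow>es. [:- a, 1:]) \<noteq> 0" by (auto simp: prod_list_zero_iff)
  thus ?case using Cons by (simp add: proots_mult del: mult_pCons_left)
qed simp

lemma proots_char_poly_upper_triangular:
  assumes "T \<in> carrier_mat n n" "upper_triangular (T :: complex mat)"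
  shows "proots (char_poly T) = {# T $$ (i, i). i \<in># mset_set {..<n} #}"
  using assms unfolding char_poly_upper_triangular[OF assms] proots_prod_list_linear
  by (simp add: diag_mat_def atLeast0LessThan)

text \<open>The Schur decomposition can be computed from any list of the eigenvalues, so an indexing of
  the spectrum can be made to coincide with positions on the diagonal. This turns the multiset of sums
  of eigenvalues into a family indexed by pairs of positions.\<close>

lemma schur_with_diagonal:
  fixes A :: "complex mat"
  assumes A: "A \<in> carrier_mat n n" and f: "proots (char_poly A) = {# f i. i \<in># mset_set {..<n} #}"
  obtains T P Q where "similar_mat_wit A T P Q" "upper_triangular T" "\<And>i. i < n \<Longrightarrow> T $$ (i, i) = f i"
proof -
  obtain as where as: "char_poly A = (\<Prod>a\<leftarrow>as. [:- a, 1:])"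
    using char_poly_factorized[OF A] by auto
  define es where "es = map f [0..<n]"
  have "mset as = mset es"
    using f unfolding as proots_prod_list_linear by (simp add: es_def atLeast0LessThan)
  hence "(\<Prod>a\<leftarrow>as. [:- a, 1:]) = (\<Prod>a\<leftarrow>es. [:- a, 1:])"
    by (metis mset_map prod_mset_prod_list)
  with as have cp: "char_poly A = (\<Prod>a\<leftarrow>es. [:- a, 1:])" by simp
  obtain T P Q where "schur_decomposition A es = (T, P, Q)" by (cases "schur_decomposition A es")
  from schur_decomposition[OF A cp this]
  have T: "similar_mat_wit A T P Q" "upper_triangular T" "diag_mat T = es" by auto
  have "T $$ (i, i) = f i" if "i < n" for i
  proof -
    have "diag_mat T ! i = f i" using T(3) that by (simp add: es_def)
    thus ?thesis using that similar_mat_witD2(5)[OF A T(1)] by (simp add: diag_mat_def)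
  qed
  with T show ?thesis using that by blast
qed

lemma eigvals_boxplus:
  assumes A: "A \<in> carrier_mat n n" and B: "B \<in> carrier_mat m m"
    and f: "eigvals A = {# f i. i \<in># mset_set {..<n} #}"
    and g: "eigvals B = {# g i. i \<in># mset_set {..<m} #}"
  shows "eigvals (A \<boxplus> B) = {# f (i div m) + g (i mod m) - 1. i \<in># mset_set {..<n * m} #}"
proof -
  let ?A = "map_mat complex_of_real A" and ?B = "map_mat complex_of_real B"
  have cA: "?A \<in> carrier_mat n n" and cB: "?B \<in> carrier_mat m m" using A B by auto
  obtain S P Q where S: "similar_mat_wit ?A S P Q" "upper_triangular S" "\<And>i. i < n \<Longrightarrow> S $$ (i, i) = f i"
    using schur_with_diagonal[OF cA] f unfolding eigvals_def by blast
  obtain T P' Q' where T: "similar_mat_wit ?B T P' Q'" "upper_triangular T" "\<And>i. i < m \<Longrightarrow> T $$ (i, i) = g i"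
    using schur_with_diagonal[OF cB] g unfolding eigvals_def by blast
  have cS: "S \<in> carrier_mat n n" and cT: "T \<in> carrier_mat m m"
    using similar_mat_witD2(5)[OF cA S(1)] similar_mat_witD2(5)[OF cB T(1)] by auto
  have "eigvals (A \<boxplus> B) = proots (char_poly (S \<boxplus> T))"
    unfolding eigvals_def map_mat_boxplus[OF A B]
    by (simp add: char_poly_similar[OF boxplus_similar[OF cA cB S(1) T(1)]])
  also have "\<dots> = {# (S \<boxplus> T) $$ (i, i). i \<in># mset_set {..<n * m} #}"
    by (rule proots_char_poly_upper_triangular[OF boxplus_carrier[OF cS cT]
          boxplus_upper_triangular[OF cS S(2) cT T(2)]])
  also have "\<dots> = {# f (i div m) + g (i mod m) - 1. i \<in># mset_set {..<n * m} #}"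
    by (rule image_mset_cong) (auto simp: boxplus_index_diag[OF cS cT] S(3) T(3) digits_less)
  finally show ?thesis .
qed

section \<open>Stationary vectors of irreducible chains\<close>

abbreviation edges :: "real mat \<Rightarrow> (nat \<times> nat) set" where
  "edges A \<equiv> {(k, l). k < dim_row A \<and> l < dim_row A \<and> A $$ (k, l) \<noteq> 0}"

lemma transpose_mult_vec_index:
  assumes "W \<in> carrier_mat n n" "p \<in> carrier_vec n" "j < n"
  shows "(transpose_mat W *\<^sub>v p) $ j = (\<Sum>i<n. W $$ (i, j) * p $ i)"
  using assms by (simp add: scalar_prod_def atLeast0LessThan)

text \<open>If \<open>r\<^sub>l = 0\<close>, stationarity writes 0 as the sum of the nonnegative terms \<open>W\<^sub>k\<^sub>l r\<^sub>k\<close>, so \<open>r\<close> also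
  vanishes at every predecessor \<open>k\<close> of \<open>l\<close>, and thus on everything that leads to the first zero.\<close>

lemma irreducible_stationary_zero:
  assumes W: "W \<in> carrier_mat n n" "\<And>i j. i < n \<Longrightarrow> j < n \<Longrightarrow> W $$ (i, j) \<ge> 0" "irreducible_mat W"
    and r: "r \<in> carrier_vec n" "transpose_mat W *\<^sub>v r = r" "\<And>i. i < n \<Longrightarrow> r $ i \<ge> 0"
    and z: "z < n" "r $ z = 0" and i: "i < n"
  shows "r $ i = 0"
proof -
  have "(i, z) \<in> (edges W)\<^sup>*" using W i z unfolding irreducible_mat_def by auto
  thus ?thesis
  proof (induction rule: converse_rtrancl_induct)
    case base
    show ?case by (rule z(2))
  next
    case (step k l)
    have kl: "k < n" "l < n" "W $$ (k, l) \<noteq> 0" using step(1) W(1) by auto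
    have "(\<Sum>i<n. W $$ (i, l) * r $ i) = 0"
      using transpose_mult_vec_index[OF W(1) r(1) kl(2)] r(2) step(3) by simp
    hence "W $$ (k, l) * r $ k = 0"
      using kl W(2) r(3) by (subst (asm) sum_nonneg_eq_0_iff) auto
    thus ?case using kl by simp
  qed
qed

text \<open>Subtract from \<open>p\<close> the largest multiple of \<open>q\<close> that keeps the difference nonnegative. The
  difference is stationary and has a zero, hence is zero; so \<open>p\<close> is a multiple of \<open>q\<close>, and the
  normalisation fixes the factor.\<close>

lemma left_Perron_vec_unique:
  assumes p: "is_left_Perron_vec W p" and q: "is_left_Perron_vec W q"
  shows "p = q"
proof -
  define n where "n = dim_row W"
  have W: "W \<in> carrier_mat n n" "\<And>i j. i < n \<Longrightarrow> j < n \<Longrightarrow> W $$ (i, j) \<ge> 0" "irreducible_mat W"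
    using p by (auto simp: is_left_Perron_vec_def stochastic_mat_def n_def)
  have P: "p \<in> carrier_vec n" "transpose_mat W *\<^sub>v p = p" "\<And>i. i < n \<Longrightarrow> p $ i > 0" "(\<Sum>i<n. p $ i) = 1"
    and Q: "q \<in> carrier_vec n" "transpose_mat W *\<^sub>v q = q" "\<And>i. i < n \<Longrightarrow> q $ i > 0" "(\<Sum>i<n. q $ i) = 1"
    using p q by (auto simp: is_left_Perron_vec_def n_def)
  have n: "{..<n} \<noteq> {}" using P(4) by (cases n) auto
  define t where "t = Min ((\<lambda>i. p $ i / q $ i) ` {..<n})"
  have "t \<in> (\<lambda>i. p $ i / q $ i) ` {..<n}" unfolding t_def using n by (intro Min_in) auto
  then obtain z where z: "z < n" "t = p $ z / q $ z" by auto
  have t: "t \<le> p $ i / q $ i" if "i < n" for i unfolding t_def using that by (intro Min_le) auto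
  define r where "r = p - t \<cdot>\<^sub>v q"
  have r: "r \<in> carrier_vec n" using P Q by (simp add: r_def)
  have ri: "r $ i = p $ i - t * q $ i" if "i < n" for i using that P Q by (simp add: r_def)
  have "transpose_mat W *\<^sub>v r = transpose_mat W *\<^sub>v p - t \<cdot>\<^sub>v (transpose_mat W *\<^sub>v q)"
    unfolding r_def using W(1) P(1) Q(1)
    by (simp add: mult_minus_distrib_mat_vec[where nr = n and nc = n] mult_mat_vec[where nr = n and nc = n])
  hence "transpose_mat W *\<^sub>v r = r" by (simp add: r_def P Q)
  moreover have "r $ i \<ge> 0" if "i < n" for i
    using t[OF that] Q(3)[OF that] by (simp add: ri[OF that] field_simps)
  moreover have "r $ z = 0" using Q(3)[OF z(1)] by (simp add: ri z)
  ultimately have "r $ i = 0" if "i < n" for i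
    using irreducible_stationary_zero[OF W r _ _ z(1) _ that] by blast
  hence pq: "p $ i = t * q $ i" if "i < n" for i using ri that by simp
  have "(\<Sum>i<n. p $ i) = t * (\<Sum>i<n. q $ i)" by (simp add: pq sum_distrib_left)
  hence "t = 1" using P(4) Q(4) by simp
  thus ?thesis using pq P(1) Q(1) by (intro eq_vecI) auto
qed

lemma left_Perron_vec_eq: "is_left_Perron_vec W p \<Longrightarrow> left_Perron_vec W = p"
  unfolding left_Perron_vec_def by (blast intro: left_Perron_vec_unique)

lemma pow_mat_add_index:
  fixes A :: "real mat"
  assumes A: "A \<in> carrier_mat n n" and ij: "i < n" "j < n"
  shows "(A ^\<^sub>m (s + t)) $$ (i, j) = (\<Sum>k<n. (A ^\<^sub>m s) $$ (i, k) * (A ^\<^sub>m t) $$ (k, j))"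
proof -
  have c: "A ^\<^sub>m k \<in> carrier_mat n n" for k by (rule pow_carrier_mat[OF A])
  have "A ^\<^sub>m (s + t) = A ^\<^sub>m s * A ^\<^sub>m t"
  proof (induction t)
    case 0
    show ?case using A c[of s] by simp
  next
    case (Suc t)
    show ?case using Suc assoc_mult_mat[OF c c A] by simp
  qed
  thus ?thesis using ij carrier_matD[OF c] by (simp add: scalar_prod_def atLeast0LessThan)
qed

text \<open>Walks from \<open>i\<close> to \<open>j\<close> through the lazy node \<open>z\<close> can be lengthened at will by waiting at \<open>z\<close>, so
  all pairs are joined by walks of one common length.\<close>

lemma primitive_if_irreducible_lazy_node:
  fixes A :: "real mat"
  assumes A: "A \<in> carrier_mat n n" and nn: "\<And>i j. i < n \<Longrightarrow> j < n \<Longrightarrow> A $$ (i, j) \<ge> 0"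
    and irr: "irreducible_mat A" and z: "z < n" "A $$ (z, z) > 0"
  shows "primitive_mat A"
proof -
  have dA: "dim_row A = n" using A by simp
  have nonneg: "(A ^\<^sub>m t) $$ (i, j) \<ge> 0" if "i < n" "j < n" for t i j
    using that
  proof (induction t arbitrary: j)
    case (Suc t)
    have "(A ^\<^sub>m (t + 1)) $$ (i, j) \<ge> 0"
      unfolding pow_mat_add_index[OF A Suc.prems] using Suc nn A by (intro sum_nonneg) auto
    thus ?case by simp
  qed (use dA in auto)
  define reach where "reach t i j \<longleftrightarrow> (A ^\<^sub>m t) $$ (i, j) > 0" for t i j
  have trans: "reach (s + t) i j" if "reach s i k" "reach t k j" "i < n" "k < n" "j < n" for s t i j k
    unfolding reach_def pow_mat_add_index[OF A that(3,5)]
    using that nonneg by (intro sum_pos2[of _ k]) (auto simp: reach_def)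
  have refl: "reach 0 i i" if "i < n" for i using that dA by (simp add: reach_def)
  have one: "reach 1 i j" if "(i, j) \<in> edges A" for i j
    using that nn[of i j] A by (auto simp: reach_def less_le)
  have ex: "\<exists>t. reach t i j" if "i < n" "j < n" for i j
  proof -
    have "(i, j) \<in> (edges A)\<^sup>*" using irr that dA unfolding irreducible_mat_def by auto
    thus ?thesis
    proof (induction rule: rtrancl_induct)
      case base
      show ?case using refl[OF that(1)] by blast
    next
      case (step k l)
      then obtain t where "reach t i k" by blast
      hence "reach (t + 1) i l" using trans[OF _ one[OF step(2)]] step(2) that(1) dA by simp
      thus ?case by blast
    qed
  qed
  have "\<forall>i. \<exists>t. i < n \<longrightarrow> reach t i z" using ex z(1) by blast
  then obtain f where f: "\<And>i. i < n \<Longrightarrow> reach (f i) i z" by metis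
  have "\<forall>j. \<exists>t. j < n \<longrightarrow> reach t z j" using ex z(1) by blast
  then obtain g where g: "\<And>j. j < n \<Longrightarrow> reach (g j) z j" by metis
  have loop: "reach t z z" for t
  proof (induction t)
    case (Suc t)
    have "(z, z) \<in> edges A" using z dA by simp
    from trans[OF Suc one[OF this]] show ?case using z by simp
  qed (use refl z in auto)
  \<comment> \<open>one exponent that exceeds the length of every chosen walk through \<open>z\<close>;
     the spare steps are spent in the loop at \<open>z\<close>\<close>
  define m where "m = (\<Sum>i<n. f i) + (\<Sum>j<n. g j) + 1"
  have "reach m i j" if "i < n" "j < n" for i j
  proof -
    have "f i \<le> (\<Sum>i<n. f i)" "g j \<le> (\<Sum>j<n. g j)" using that by (auto intro: member_le_sum)
    hence m: "m = f i + ((m - f i - g j) + g j)" by (simp add: m_def)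
    show ?thesis
      by (subst m) (rule trans[OF f[OF that(1)] trans[OF loop g[OF that(2)] z(1) z(1) that(2)] that(1) z(1) that(2)])
  qed
  moreover have "m > 0" by (simp add: m_def)
  ultimately show ?thesis unfolding primitive_mat_def reach_def dA by blast
qed

lemma ones_mult_iff:
  assumes A: "A \<in> carrier_mat n n"
  shows "A *\<^sub>v vec n (\<lambda>_. 1) = vec n (\<lambda>_. 1) \<longleftrightarrow> (\<forall>i<n. (\<Sum>j<n. A $$ (i, j)) = (1::real))"
  using A by (auto simp: vec_eq_iff scalar_prod_def atLeast0LessThan)

lemma boxplus_ones:
  fixes A B :: "real mat"
  assumes "A \<in> carrier_mat n n" "B \<in> carrier_mat m m"
    and "A *\<^sub>v vec n (\<lambda>_. 1) = vec n (\<lambda>_. 1)" "B *\<^sub>v vec m (\<lambda>_. 1) = vec m (\<lambda>_. 1)"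
  shows "(A \<boxplus> B) *\<^sub>v vec (n * m) (\<lambda>_. 1) = vec (n * m) (\<lambda>_. 1)"
proof -
  have "vec n (\<lambda>_. 1) \<otimes>\<^sub>v vec m (\<lambda>_. 1) = vec (n * m) (\<lambda>_. 1)"
    by (rule eq_vecI) (auto simp: kron_vec_def digits_less)
  thus ?thesis using boxplus_fixes_kron_vec[OF assms(1,2) _ assms(3) _ assms(4)] by simp
qed

text \<open>Change the leading digit along a walk for \<open>A\<close>, then the other digit along a walk for \<open>B\<close>. Loops
  in these walks are skipped: a loop of \<open>A\<close> need not be one of \<open>A \<boxplus> B\<close>, where \<open>B\<close> and the subtracted identity
  contribute to the diagonal.\<close>

lemma boxplus_irreducible:
  assumes A: "A \<in> carrier_mat n n" "irreducible_mat A" and B: "B \<in> carrier_mat m m" "irreducible_mat B"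
  shows "irreducible_mat (A \<boxplus> B)"
proof -
  let ?R = "edges (A \<boxplus> B)"
  have d: "dim_row A = n" "dim_row B = m" "dim_row (A \<boxplus> B) = n * m"
    using A B carrier_matD[OF boxplus_carrier[OF A(1) B(1)]] by auto
  have moveA: "(k * m + s, l * m + s) \<in> ?R\<^sup>*" if "k < n" "l < n" "s < m" for k l s
  proof -
    have "(k, l) \<in> (edges A)\<^sup>*" using A(2) that d unfolding irreducible_mat_def by auto
    thus ?thesis
    proof (induction rule: rtrancl_induct)
      case (step x y)
      have xy: "x < n" "y < n" "A $$ (x, y) \<noteq> 0" using step(2) d by auto
      show ?case
      proof (cases "x = y")
        case False
        hence "(x * m + s, y * m + s) \<in> ?R"
          using xy that number_less[OF xy(1) that(3)] number_less[OF xy(2) that(3)] d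
          by (auto simp: boxplus_index[OF A(1) B(1)])
        with step(3) show ?thesis by (rule rtrancl_into_rtrancl)
      qed (use step in auto)
    qed auto
  qed
  have moveB: "(x * m + k, x * m + l) \<in> ?R\<^sup>*" if "x < n" "k < m" "l < m" for k l x
  proof -
    have "(k, l) \<in> (edges B)\<^sup>*" using B(2) that d unfolding irreducible_mat_def by auto
    thus ?thesis
    proof (induction rule: rtrancl_induct)
      case (step s t)
      have st: "s < m" "t < m" "B $$ (s, t) \<noteq> 0" using step(2) d by auto
      show ?case
      proof (cases "s = t")
        case False
        hence "(x * m + s, x * m + t) \<in> ?R"
          using st that number_less[OF that(1) st(1)] number_less[OF that(1) st(2)] d
          by (auto simp: boxplus_index[OF A(1) B(1)])
        with step(3) show ?thesis by (rule rtrancl_into_rtrancl)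
      qed (use step in auto)
    qed auto
  qed
  have "(i, j) \<in> ?R\<^sup>*" if "i < n * m" "j < n * m" for i j
  proof -
    note e = digits_less[OF that(1)] digits_less[OF that(2)]
    have "(i div m * m + i mod m, j div m * m + j mod m) \<in> ?R\<^sup>*"
      using moveA[OF e(1,3,2)] moveB[OF e(3,2,4)] by (rule rtrancl_trans)
    thus ?thesis by (simp only: div_mult_mod_eq)
  qed
  thus ?thesis unfolding irreducible_mat_def d by blast
qed

text \<open>Nonnegativity is a hypothesis because the diagonal entries of \<open>A \<boxplus> B\<close> are sums
  \<open>A\<^sub>k\<^sub>k + B\<^sub>l\<^sub>l - 1\<close>, which can be negative.\<close>

lemma is_left_Perron_vec_boxplus:
  assumes p: "is_left_Perron_vec A p" and q: "is_left_Perron_vec B q"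
    and nn: "\<And>i j. i < dim_row A * dim_row B \<Longrightarrow> j < dim_row A * dim_row B \<Longrightarrow> (A \<boxplus> B) $$ (i, j) \<ge> 0"
    and z: "z < dim_row A * dim_row B" "(A \<boxplus> B) $$ (z, z) > 0"
  shows "is_left_Perron_vec (A \<boxplus> B) (p \<otimes>\<^sub>v q)"
proof -
  define n m where "n = dim_row A" and "m = dim_row B"
  have A: "A \<in> carrier_mat n n" "irreducible_mat A" "A *\<^sub>v vec n (\<lambda>_. 1) = vec n (\<lambda>_. 1)"
    and P: "p \<in> carrier_vec n" "transpose_mat A *\<^sub>v p = p" "\<And>i. i < n \<Longrightarrow> p $ i > 0" "(\<Sum>i<n. p $ i) = 1"
    using p by (auto simp: is_left_Perron_vec_def stochastic_mat_def n_def)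
  have B: "B \<in> carrier_mat m m" "irreducible_mat B" "B *\<^sub>v vec m (\<lambda>_. 1) = vec m (\<lambda>_. 1)"
    and Q: "q \<in> carrier_vec m" "transpose_mat B *\<^sub>v q = q" "\<And>i. i < m \<Longrightarrow> q $ i > 0" "(\<Sum>i<m. q $ i) = 1"
    using q by (auto simp: is_left_Perron_vec_def stochastic_mat_def m_def)
  note C = boxplus_carrier[OF A(1) B(1)]
  have dC: "dim_row (A \<boxplus> B) = n * m" using C by simp
  have irr: "irreducible_mat (A \<boxplus> B)" by (rule boxplus_irreducible[OF A(1,2) B(1,2)])
  have pq: "(p \<otimes>\<^sub>v q) $ i = p $ (i div m) * q $ (i mod m)" if "i < n * m" for i
    using that P(1) Q(1) by (simp add: kron_vec_def)
  have "stochastic_mat (A \<boxplus> B)"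
    unfolding stochastic_mat_def dC using boxplus_ones[OF A(1) B(1) A(3) B(3)] C nn
    by (auto simp: n_def m_def)
  moreover have "primitive_mat (A \<boxplus> B)"
    using primitive_if_irreducible_lazy_node[OF C _ irr] nn z by (simp add: n_def m_def)
  moreover have "transpose_mat (A \<boxplus> B) *\<^sub>v (p \<otimes>\<^sub>v q) = p \<otimes>\<^sub>v q"
    unfolding boxplus_transpose[OF A(1) B(1)]
    using A(1) B(1) P(1,2) Q(1,2) by (intro boxplus_fixes_kron_vec) auto
  moreover have "(p \<otimes>\<^sub>v q) $ i > 0" if "i < n * m" for i
    using P(3) Q(3) digits_less[OF that] by (simp add: pq[OF that])
  moreover have "(\<Sum>i<n * m. (p \<otimes>\<^sub>v q) $ i) = 1"
  proof -
    have "(\<Sum>i<n * m. (p \<otimes>\<^sub>v q) $ i) = (\<Sum>i<n * m. p $ (i div m) * q $ (i mod m))"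
      by (rule sum.cong) (auto simp: pq)
    also have "\<dots> = (\<Sum>i<n. p $ i) * (\<Sum>j<m. q $ j)"
      unfolding sum_digits[of "\<lambda>i j. p $ i * q $ j"] by (simp add: sum_product)
    finally show ?thesis by (simp add: P Q)
  qed
  moreover have "p \<otimes>\<^sub>v q \<in> carrier_vec (n * m)" using P Q by (auto simp: kron_vec_def)
  ultimately show ?thesis unfolding is_left_Perron_vec_def dC using irr by blast
qed

section \<open>Weight matrices of paths and lattices\<close>

lemma weight_mat_carrier [simp]: "weight_mat n w \<in> carrier_mat n n"
  by (simp add: weight_mat_def)

lemma weight_mat_ones: "weight_mat n w *\<^sub>v vec n (\<lambda>_. 1) = vec n (\<lambda>_. 1)"
proof -
  have "(\<Sum>j<n. weight_mat n w $$ (i, j)) = 1" if "i < n" for i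
  proof -
    have "(\<Sum>j<n. weight_mat n w $$ (i, j)) =
        weight_mat n w $$ (i, i) + (\<Sum>j\<in>{..<n} - {i}. weight_mat n w $$ (i, j))"
      using that by (simp add: sum.remove)
    also have "(\<Sum>j\<in>{..<n} - {i}. weight_mat n w $$ (i, j)) = (\<Sum>j\<in>{..<n} - {i}. w i j)"
      using that by (intro sum.cong) (auto simp: weight_mat_def)
    finally show ?thesis using that by (simp add: weight_mat_def)
  qed
  thus ?thesis by (simp add: ones_mult_iff)
qed

text \<open>A weight matrix is determined by its off-diagonal entries and its row sums, so the sums that
  define its diagonal need not be computed in order to recognise it.\<close>

lemma weight_mat_eqI:
  assumes A: "A \<in> carrier_mat n n" "A *\<^sub>v vec n (\<lambda>_. 1) = vec n (\<lambda>_. 1)"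
    and w: "\<And>i j. i < n \<Longrightarrow> j < n \<Longrightarrow> i \<noteq> j \<Longrightarrow> A $$ (i, j) = w i j"
  shows "weight_mat n w = A"
proof (rule eq_matI)
  fix i j assume "i < dim_row A" "j < dim_col A"
  hence ij: "i < n" "j < n" using A(1) by auto
  have "1 = (\<Sum>j<n. A $$ (i, j))" using A ij ones_mult_iff[OF A(1)] by simp
  also have "\<dots> = A $$ (i, i) + (\<Sum>j\<in>{..<n} - {i}. w i j)"
    using ij w by (simp add: sum.remove)
  finally show "weight_mat n w $$ (i, j) = A $$ (i, j)"
    using ij w by (auto simp: weight_mat_def)
qed (use A in \<open>auto simp: weight_mat_def\<close>)

lemma path_mat_carrier [simp]: "path_mat n a c \<in> carrier_mat n n"
  by (simp add: path_mat_def)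

lemma path_mat_offdiag:
  assumes "i < n" "j < n" "i \<noteq> j"
  shows "path_mat n a c $$ (i, j) = (if j = i + 1 then c else if i = j + 1 then a else 0)"
  using assms by (simp add: path_mat_def weight_mat_def)

text \<open>At node 0 the weight \<open>a\<close> is absent. This sharper bound gives a positive diagonal entry
  even when \<open>a + c = 1\<close>.\<close>

lemma path_mat_diag_ge:
  assumes "i < n" "a \<ge> 0" "c \<ge> 0"
  shows "path_mat n a c $$ (i, i) \<ge> 1 - (if i = 0 then 0 else a) - c"
proof -
  \<comment> \<open>the node below \<open>i\<close> is \<open>i - 1\<close>; for \<open>i = 0\<close> this truncates to 0, where the inner conditional
     makes the term vanish\<close>
  have "(\<Sum>k\<in>{..<n} - {i}. if k = i + 1 then c else if i = k + 1 then a else 0) \<le>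
      (\<Sum>k\<in>{..<n} - {i}. (if k = i + 1 then c else 0) + (if k = i - 1 then (if i = 0 then 0 else a) else 0))"
    using assms by (intro sum_mono) auto
  also have "\<dots> \<le> c + (if i = 0 then 0 else a)"
    using assms unfolding sum.distrib by (intro add_mono) auto
  finally show ?thesis using assms by (simp add: path_mat_def weight_mat_def)
qed

lemma path_mat_nonneg:
  assumes "a \<ge> 0" "c \<ge> 0" "a + c \<le> 1" "i < n" "j < n"
  shows "path_mat n a c $$ (i, j) \<ge> 0"
  using assms path_mat_diag_ge[of i n a c] by (cases "i = j") (auto simp: path_mat_offdiag split: if_splits)

lemma path_mat_irreducible:
  assumes "a > 0" "c > 0"
  shows "irreducible_mat (path_mat n a c)"
proof -
  let ?R = "edges (path_mat n a c)"
  have d: "dim_row (path_mat n a c) = n" by (simp add: path_mat_def weight_mat_def)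
  have step: "(i, Suc i) \<in> ?R" "(Suc i, i) \<in> ?R" if "Suc i < n" for i
    using that assms by (auto simp: d path_mat_offdiag)
  have "(0, i) \<in> ?R\<^sup>* \<and> (i, 0) \<in> ?R\<^sup>*" if "i < n" for i
    using that
  proof (induction i)
    case (Suc i)
    thus ?case using step[OF Suc.prems]
      by (meson Suc_lessD converse_rtrancl_into_rtrancl rtrancl_into_rtrancl)
  qed simp
  thus ?thesis unfolding irreducible_mat_def d by (meson rtrancl_trans)
qed

lemma path_mat_has_left_Perron_vec:
  assumes n: "n \<ge> 1" and ac: "a > 0" "c > 0" "a + c \<le> 1"
  shows "\<exists>p. is_left_Perron_vec (path_mat n a c) p"
proof -
  let ?W = "path_mat n a c"
  have C: "?W \<in> carrier_mat n n" by simp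
  have d: "dim_row ?W = n" by (rule carrier_matD(1)[OF C])
  have nn: "?W $$ (i, j) \<ge> 0" if "i < n" "j < n" for i j
    using path_mat_nonneg that ac by simp
  have ones: "?W *\<^sub>v vec n (\<lambda>_. 1) = vec n (\<lambda>_. 1)" unfolding path_mat_def by (rule weight_mat_ones)
  define Z where "Z = (\<Sum>i<n. (c / a) ^ i)"
  define p where "p = vec n (\<lambda>i. (c / a) ^ i / Z)"
  have Z: "Z > 0" unfolding Z_def using n ac by (intro sum_pos) (auto simp: lessThan_empty_iff)
  \<comment> \<open>detailed balance: the flow along each edge equals the flow back\<close>
  have bal: "?W $$ (i, j) * p $ i = ?W $$ (j, i) * p $ j" if "i < n" "j < n" for i j
    using that ac Z by (cases "i = j") (auto simp: path_mat_offdiag p_def field_simps)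
  have st: "transpose_mat ?W *\<^sub>v p = p"
  proof (rule eq_vecI)
    fix j assume "j < dim_vec p"
    hence j: "j < n" by (simp add: p_def)
    have "(transpose_mat ?W *\<^sub>v p) $ j = (\<Sum>i<n. ?W $$ (i, j) * p $ i)"
      using j by (intro transpose_mult_vec_index) (auto simp: p_def)
    also have "\<dots> = (\<Sum>i<n. ?W $$ (j, i)) * p $ j"
      unfolding sum_distrib_right using bal j by (intro sum.cong) auto
    finally show "(transpose_mat ?W *\<^sub>v p) $ j = p $ j"
      using ones j unfolding ones_mult_iff[OF C] by simp
  qed (simp add: p_def carrier_matD(2)[OF C])
  have irr: "irreducible_mat ?W" using ac by (intro path_mat_irreducible)
  have "?W $$ (0, 0) > 0" using path_mat_diag_ge[of 0 n a c] n ac by simp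
  hence prim: "primitive_mat ?W"
    using n by (intro primitive_if_irreducible_lazy_node[OF C nn irr, of 0]) auto
  have "(\<Sum>i<n. p $ i) = (\<Sum>i<n. (c / a) ^ i) / Z" by (simp add: p_def sum_divide_distrib)
  hence "(\<Sum>i<n. p $ i) = 1" using Z by (simp add: Z_def)
  moreover have "stochastic_mat ?W" unfolding stochastic_mat_def square_mat.simps d carrier_matD(2)[OF C]
    using nn ones by blast
  moreover have "p $ i > 0" if "i < n" for i using that ac Z by (simp add: p_def)
  ultimately have "is_left_Perron_vec ?W p"
    unfolding is_left_Perron_vec_def d using st irr prim by (simp add: p_def)
  thus ?thesis ..
qed

lemma num_nodes_Suc: "num_nodes (Suc D) N = N D * num_nodes D N"
  by (simp add: num_nodes_def mult.commute)

lemma lattice_coord_top: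
  assumes "i < num_nodes (Suc D) N"
  shows "lattice_coord N i D = i div num_nodes D N"
  using digits_less(1)[of i "N D" "num_nodes D N"] assms
  by (simp add: lattice_coord_def num_nodes_Suc) (simp add: num_nodes_def)

text \<open>The lower coordinates depend only on the position within a layer of constant top
  coordinate.\<close>

lemma lattice_coord_mod:
  assumes "d < D"
  shows "lattice_coord N (i mod num_nodes D N) d = lattice_coord N i d"
proof -
  let ?P = "\<Prod>e<d. N e"
  have "num_nodes (Suc d) N dvd num_nodes D N"
    unfolding num_nodes_def using assms by (intro prod_dvd_prod_subset) auto
  then obtain q where "num_nodes D N = num_nodes (Suc d) N * q" by (rule dvdE)
  hence q: "num_nodes D N = ?P * (N d * q)" by (simp add: num_nodes_def mult.assoc)
  have "i mod (P * R) div P = (i div P) mod R" for P R :: nat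
    by (cases "P = 0") (auto simp: mod_mult2_eq)
  hence "i mod num_nodes D N div ?P = (i div ?P) mod (N d * q)" unfolding q .
  thus ?thesis by (simp add: lattice_coord_def mod_mult_right_eq mod_mod_cancel)
qed

lemma lattice_coord_inj:
  assumes "i < num_nodes D N" "j < num_nodes D N"
    and "\<And>d. d < D \<Longrightarrow> lattice_coord N i d = lattice_coord N j d"
  shows "i = j"
  using assms
proof (induction D arbitrary: i j)
  case (Suc D)
  let ?M = "num_nodes D N"
  have "i mod ?M < ?M" "j mod ?M < ?M"
    using Suc.prems(1,2) digits_less(2) unfolding num_nodes_Suc by blast+
  hence "i mod ?M = j mod ?M"
    by (rule Suc.IH) (simp add: lattice_coord_mod Suc.prems(3))
  moreover have "i div ?M = j div ?M"
    using Suc.prems lattice_coord_top[of i D N] lattice_coord_top[of j D N] by simp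
  ultimately show ?case using digits_eq_iff[of i ?M j] by blast
qed (simp add: num_nodes_def)

lemma lattice_weight_Suc_same_layer:
  assumes ij: "i < num_nodes (Suc D) N" "j < num_nodes (Suc D) N"
    and eq: "i div num_nodes D N = j div num_nodes D N"
  shows "lattice_weight (Suc D) N a c i j =
    lattice_weight D N a c (i mod num_nodes D N) (j mod num_nodes D N)"
proof -
  let ?M = "num_nodes D N"
  have m: "i mod ?M < ?M" "j mod ?M < ?M"
    using ij digits_less(2) unfolding num_nodes_Suc by blast+
  have top: "lattice_coord N i D = lattice_coord N j D"
    using eq ij by (simp add: lattice_coord_top)
  have adj: "lattice_adj (Suc D) N i j \<longleftrightarrow> lattice_adj D N (i mod ?M) (j mod ?M)"
    unfolding lattice_adj_iff using ij m top
    by (auto simp: lattice_coord_mod less_Suc_eq)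
  show ?thesis
    unfolding lattice_weight_def pos_neighbor_def neg_neighbor_def adj
    by (simp add: top) (rule sum.cong, simp_all add: lattice_coord_mod)
qed

lemma lattice_weight_Suc_other_layer:
  assumes ij: "i < num_nodes (Suc D) N" "j < num_nodes (Suc D) N"
    and ne: "i div num_nodes D N \<noteq> j div num_nodes D N"
  shows "lattice_weight (Suc D) N a c i j =
    (if i mod num_nodes D N = j mod num_nodes D N
     then if j div num_nodes D N = i div num_nodes D N + 1 then c D
          else if i div num_nodes D N = j div num_nodes D N + 1 then a D else 0
     else 0)"
proof -
  let ?M = "num_nodes D N"
  have m: "i mod ?M < ?M" "j mod ?M < ?M"
    using ij digits_less(2) unfolding num_nodes_Suc by blast+
  note top = lattice_coord_top[OF ij(1)] lattice_coord_top[OF ij(2)]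
  have low: "(\<forall>d<D. lattice_coord N j d = lattice_coord N i d) \<longleftrightarrow> i mod ?M = j mod ?M"
    using lattice_coord_inj[OF m] by (metis lattice_coord_mod)
  have ne': "lattice_coord N j D \<noteq> lattice_coord N i D" using ne by (simp add: top)
  have ex: "(\<exists>d<Suc D. near d \<and> (\<forall>e<Suc D. e \<noteq> d \<longrightarrow> same e)) \<longleftrightarrow> near D \<and> (\<forall>e<D. same e)"
    if "\<not> same D" for near same :: "nat \<Rightarrow> bool"
    using that by (auto simp: less_Suc_eq)
  have adj: "lattice_adj (Suc D) N i j \<longleftrightarrow>
      (j div ?M = i div ?M + 1 \<or> i div ?M = j div ?M + 1) \<and> i mod ?M = j mod ?M"
    unfolding lattice_adj_iff low[symmetric] top[symmetric]
      ex[where same = "\<lambda>e. lattice_coord N j e = lattice_coord N i e", OF ne']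
    using ij by blast
  have no_lower: "\<not> pos_neighbor (Suc D) N d i j" "\<not> neg_neighbor (Suc D) N d i j" if "d < D" for d
    using that low unfolding pos_neighbor_def neg_neighbor_def adj by (metis less_irrefl)+
  have "lattice_weight (Suc D) N a c i j =
      (if pos_neighbor (Suc D) N D i j then c D else if neg_neighbor (Suc D) N D i j then a D else 0)"
    unfolding lattice_weight_def by (simp add: no_lower)
  thus ?thesis using ne by (auto simp: pos_neighbor_def neg_neighbor_def adj top)
qed

lemma lattice_mat_carrier [simp]: "lattice_mat D N a c \<in> carrier_mat (num_nodes D N) (num_nodes D N)"
  by (simp add: lattice_mat_def)

lemma lattice_mat_0: "lattice_mat 0 N a c = 1\<^sub>m 1"
  unfolding lattice_mat_def by (rule weight_mat_eqI) (auto simp: num_nodes_def)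

lemma lattice_mat_Suc:
  "lattice_mat (Suc D) N a c = path_mat (N D) (a D) (c D) \<boxplus> lattice_mat D N a c"
proof -
  let ?M = "num_nodes D N" and ?A = "path_mat (N D) (a D) (c D)" and ?B = "lattice_mat D N a c"
  have C: "?A \<in> carrier_mat (N D) (N D)" "?B \<in> carrier_mat ?M ?M" by auto
  have "weight_mat (N D * ?M) (lattice_weight (Suc D) N a c) = ?A \<boxplus> ?B"
  proof (rule weight_mat_eqI)
    show "(?A \<boxplus> ?B) *\<^sub>v vec (N D * ?M) (\<lambda>_. 1) = vec (N D * ?M) (\<lambda>_. 1)"
      by (rule boxplus_ones[OF C]) (simp_all add: path_mat_def lattice_mat_def weight_mat_ones)
  next
    fix i j assume ij: "i < N D * ?M" "j < N D * ?M" and ne: "i \<noteq> j"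
    note d = digits_less[OF ij(1)] digits_less[OF ij(2)]
    show "(?A \<boxplus> ?B) $$ (i, j) = lattice_weight (Suc D) N a c i j"
    proof (cases "i div ?M = j div ?M")
      case True
      hence "i mod ?M \<noteq> j mod ?M" using ne digits_eq_iff[of i ?M j] by blast
      thus ?thesis using True ne d ij
        by (simp add: boxplus_index[OF C ij] lattice_weight_Suc_same_layer num_nodes_Suc)
           (simp add: lattice_mat_def weight_mat_def)
    next
      case False
      thus ?thesis using ne d ij
        by (simp add: boxplus_index[OF C ij] lattice_weight_Suc_other_layer num_nodes_Suc path_mat_offdiag)
    qed
  qed (use C in auto)
  thus ?thesis by (simp add: lattice_mat_def num_nodes_Suc)
qed

text \<open>Along the induction on the dimension the deficits \<open>1 - W\<^sub>i\<^sub>i\<close> of the factors add up. The corner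
  node 0 stays at coordinate 0 on every axis and so keeps the sharper bound without \<open>a\<close>.\<close>

lemma lattice_mat_bounds:
  assumes "\<And>d. d < D \<Longrightarrow> a d \<ge> 0" "\<And>d. d < D \<Longrightarrow> c d \<ge> 0"
  shows "\<lbrakk>i < num_nodes D N; j < num_nodes D N; i \<noteq> j\<rbrakk> \<Longrightarrow> lattice_mat D N a c $$ (i, j) \<ge> 0"
    and "i < num_nodes D N \<Longrightarrow>
      lattice_mat D N a c $$ (i, i) \<ge> 1 - (\<Sum>d<D. (if i = 0 then 0 else a d) + c d)"
proof -
  assume "i < num_nodes D N" "j < num_nodes D N" "i \<noteq> j"
  hence "lattice_mat D N a c $$ (i, j) = lattice_weight D N a c i j"
    by (simp add: lattice_mat_def weight_mat_def)
  also have "\<dots> \<ge> 0"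
    unfolding lattice_weight_def by (rule sum_nonneg) (simp add: assms)
  finally show "lattice_mat D N a c $$ (i, j) \<ge> 0" .
next
  show "i < num_nodes D N \<Longrightarrow>
      lattice_mat D N a c $$ (i, i) \<ge> 1 - (\<Sum>d<D. (if i = 0 then 0 else a d) + c d)"
    using assms
  proof (induction D arbitrary: i)
    case 0
    thus ?case by (simp add: lattice_mat_0 num_nodes_def)
  next
    case (Suc D)
    let ?M = "num_nodes D N"
    have i: "i < N D * ?M" using Suc.prems(1) by (simp add: num_nodes_Suc)
    note e = digits_less[OF i]
    have "lattice_mat D N a c $$ (i mod ?M, i mod ?M) \<ge>
        1 - (\<Sum>d<D. (if i mod ?M = 0 then 0 else a d) + c d)"
      using Suc.prems e by (intro Suc.IH) auto
    moreover have "(\<Sum>d<D. (if i mod ?M = 0 then 0 else a d) + c d) \<le>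
        (\<Sum>d<D. (if i = 0 then 0 else a d) + c d)"
      using Suc.prems by (intro sum_mono) auto
    moreover have "path_mat (N D) (a D) (c D) $$ (i div ?M, i div ?M) \<ge>
        1 - (if i div ?M = 0 then 0 else a D) - c D"
      using Suc.prems e by (intro path_mat_diag_ge) auto
    moreover have "(if i div ?M = 0 then 0 else a D) \<le> (if i = 0 then 0 else a D)"
      using Suc.prems(2)[of D] by auto
    ultimately show ?case
      by (simp add: lattice_mat_Suc boxplus_index_diag[OF path_mat_carrier lattice_mat_carrier i])
  qed
qed

section \<open>Spectrum and Perron vector of the lattice\<close>

lemma eigvals_lattice_mat_by_node:
  assumes "\<And>d. d < D \<Longrightarrow> eigvals (path_mat (N d) (a d) (c d)) = {# lam d l. l \<in># mset_set {..<N d} #}"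
  shows "eigvals (lattice_mat D N a c) =
    {# 1 - (\<Sum>d<D. 1 - lam d (lattice_coord N i d)). i \<in># mset_set {..<num_nodes D N} #}"
  using assms
proof (induction D)
  case 0
  have "eigvals (1\<^sub>m 1) = {#1#}"
    by (simp add: eigvals_def char_poly_def char_poly_matrix_def det_single)
  thus ?case by (simp add: lattice_mat_0 num_nodes_def lessThan_Suc)
next
  case (Suc D)
  let ?M = "num_nodes D N"
  have "eigvals (lattice_mat (Suc D) N a c) =
      {# lam D (i div ?M) + (1 - (\<Sum>d<D. 1 - lam d (lattice_coord N (i mod ?M) d))) - 1.
         i \<in># mset_set {..<N D * ?M} #}"
    unfolding lattice_mat_Suc
    by (rule eigvals_boxplus[OF path_mat_carrier lattice_mat_carrier]) (simp_all add: Suc)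
  also have "\<dots> = {# 1 - (\<Sum>d<Suc D. 1 - lam d (lattice_coord N i d)).
      i \<in># mset_set {..<N D * ?M} #}"
    by (rule image_mset_cong) (simp add: lattice_coord_mod lattice_coord_top num_nodes_Suc)
  finally show ?case by (simp add: num_nodes_Suc)
qed

lemma bij_betw_lattice_coords:
  "bij_betw (\<lambda>i. restrict (lattice_coord N i) {..<D}) {..<num_nodes D N} (\<Pi>\<^sub>E d\<in>{..<D}. {..<N d})"
proof (rule bij_betw_imageI)
  show "inj_on (\<lambda>i. restrict (lattice_coord N i) {..<D}) {..<num_nodes D N}"
  proof (rule inj_onI)
    fix i j assume ij: "i \<in> {..<num_nodes D N}" "j \<in> {..<num_nodes D N}"
      and eq: "restrict (lattice_coord N i) {..<D} = restrict (lattice_coord N j) {..<D}"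
    have "lattice_coord N i d = lattice_coord N j d" if "d < D" for d
      using fun_cong[OF eq, of d] that by simp
    thus "i = j" using ij lattice_coord_inj[of i D N j] by simp
  qed
  show "(\<lambda>i. restrict (lattice_coord N i) {..<D}) ` {..<num_nodes D N} = (\<Pi>\<^sub>E d\<in>{..<D}. {..<N d})"
  proof (intro equalityI subsetI)
    fix l assume "l \<in> (\<lambda>i. restrict (lattice_coord N i) {..<D}) ` {..<num_nodes D N}"
    then obtain i where i: "i < num_nodes D N" "l = restrict (lattice_coord N i) {..<D}" by auto
    have "N d > 0" if "d < D" for d
    proof (rule Nat.gr0I)
      assume "N d = 0"
      hence "num_nodes D N = 0" unfolding num_nodes_def using that by (intro prod_zero) auto
      thus False using i(1) by simp
    qed
    thus "l \<in> (\<Pi>\<^sub>E d\<in>{..<D}. {..<N d})" using i by (auto simp: lattice_coord_def)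
  next
    fix l assume l: "l \<in> (\<Pi>\<^sub>E d\<in>{..<D}. {..<N d})"
    hence less: "l d < N d" if "d < D" for d using that by auto
    define i where "i = (\<Sum>d<D. l d * (\<Prod>e<d. N e))"
    have "i < num_nodes D N" unfolding i_def by (rule lattice_number_less) (rule less)
    moreover have "l = restrict (lattice_coord N i) {..<D}"
    proof (rule ext)
      fix d
      show "l d = restrict (lattice_coord N i) {..<D} d"
      proof (cases "d < D")
        case True
        thus ?thesis unfolding i_def by (simp add: lattice_coord_number[OF less])
      next
        case False
        thus ?thesis using PiE_arb[OF l, of d] by simp
      qed
    qed
    ultimately show "l \<in> (\<lambda>i. restrict (lattice_coord N i) {..<D}) ` {..<num_nodes D N}" by blast
  qed
qed

lemma kron_vecs_1: "kron_vecs (Suc 0) p = p 0"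
  by (simp add: kron_vecs_def)

lemma kron_vecs_Suc: "D \<ge> 1 \<Longrightarrow> kron_vecs (Suc D) p = p D \<otimes>\<^sub>v kron_vecs D p"
  by (simp add: kron_vecs_def)

lemma is_left_Perron_vec_one: "is_left_Perron_vec (1\<^sub>m 1) (vec 1 (\<lambda>_. 1))"
  by (auto simp: is_left_Perron_vec_def stochastic_mat_def irreducible_mat_def primitive_mat_def
      intro!: exI[of _ 1])

lemma kron_vec_one: "p \<otimes>\<^sub>v vec 1 (\<lambda>_. 1) = p"
  by (rule eq_vecI) (simp_all add: kron_vec_def)

text \<open>The induction starts at \<open>D = 0\<close>, where the lattice is a single node with Perron vector \<open>(1)\<close>. The
  Kronecker product \<open>kron_vecs D\<close> starts from its first factor instead, whence the case
  distinction.\<close>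

lemma is_left_Perron_vec_lattice_mat:
  assumes "\<And>d. d < D \<Longrightarrow> N d \<ge> 1" "\<And>d. d < D \<Longrightarrow> a d > 0" "\<And>d. d < D \<Longrightarrow> c d > 0"
    and "(\<Sum>d<D. a d + c d) \<le> 1"
    and "\<And>d. d < D \<Longrightarrow> is_left_Perron_vec (path_mat (N d) (a d) (c d)) (p d)"
  shows "is_left_Perron_vec (lattice_mat D N a c) (if D = 0 then vec 1 (\<lambda>_. 1) else kron_vecs D p)"
  using assms
proof (induction D)
  case 0
  show ?case using is_left_Perron_vec_one by (simp add: lattice_mat_0)
next
  case (Suc D)
  let ?A = "path_mat (N D) (a D) (c D)" and ?B = "lattice_mat D N a c"
  let ?q = "if D = 0 then vec 1 (\<lambda>_. 1) else kron_vecs D p"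
  have d: "dim_row ?A * dim_row ?B = num_nodes (Suc D) N"
    by (metis carrier_matD(1) lattice_mat_carrier num_nodes_Suc path_mat_carrier)
  have "a D + c D > 0" using Suc.prems(2,3)[of D] by simp
  hence "(\<Sum>d<D. a d + c d) \<le> 1" using Suc.prems(4) by simp
  hence IH: "is_left_Perron_vec ?B ?q" using Suc.prems by (intro Suc.IH) auto
  have nn: "a d \<ge> 0" "c d \<ge> 0" if "d < Suc D" for d
    using Suc.prems(2,3)[of d] that by (auto intro: less_imp_le)
  have pos: "(?A \<boxplus> ?B) $$ (0, 0) > 0"
  proof -
    have "num_nodes (Suc D) N > 0"
      unfolding num_nodes_def using Suc.prems(1) by (intro prod_pos) (auto simp: Suc_le_eq)
    hence "1 - (\<Sum>d<Suc D. c d) \<le> (?A \<boxplus> ?B) $$ (0, 0)"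
      using lattice_mat_bounds(2)[of "Suc D" a c 0 N] nn by (simp add: lattice_mat_Suc)
    moreover have "(\<Sum>d<Suc D. a d) > 0" using Suc.prems(2) by (intro sum_pos) auto
    ultimately show ?thesis using Suc.prems(4) unfolding sum.distrib by linarith
  qed
  have "is_left_Perron_vec (?A \<boxplus> ?B) (p D \<otimes>\<^sub>v ?q)"
  proof (rule is_left_Perron_vec_boxplus[where z = 0], unfold d)
    show "is_left_Perron_vec ?A (p D)" using Suc.prems(5) by simp
    show "is_left_Perron_vec ?B ?q" by (rule IH)
    show "0 < num_nodes (Suc D) N"
      unfolding num_nodes_def using Suc.prems(1) by (intro prod_pos) (auto simp: Suc_le_eq)
    show "(?A \<boxplus> ?B) $$ (0, 0) > 0" by (rule pos)
    fix i j assume ij: "i < num_nodes (Suc D) N" "j < num_nodes (Suc D) N"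
    show "(?A \<boxplus> ?B) $$ (i, j) \<ge> 0"
    proof (cases "i = j")
      case True
      have "(\<Sum>d<Suc D. (if i = 0 then 0 else a d) + c d) \<le> (\<Sum>d<Suc D. a d + c d)"
        using nn by (intro sum_mono) auto
      thus ?thesis
        using lattice_mat_bounds(2)[of "Suc D" a c i N] nn ij True Suc.prems(4)
        unfolding lattice_mat_Suc by force
    next
      case False
      thus ?thesis using lattice_mat_bounds(1)[of "Suc D" a c i N j] nn ij by (simp add: lattice_mat_Suc)
    qed
  qed
  moreover have "p D \<otimes>\<^sub>v ?q = kron_vecs (Suc D) p"
    by (cases "D = 0") (simp_all add: kron_vec_one kron_vecs_1 kron_vecs_Suc del: One_nat_def)
  ultimately show ?case by (simp add: lattice_mat_Suc)
qed

theorem lemma2: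
  fixes D :: nat and N :: "nat \<Rightarrow> nat" and a c :: "nat \<Rightarrow> real"
    and lam :: "nat \<Rightarrow> nat \<Rightarrow> complex"
  assumes "D \<ge> 1"
    and "\<And>d. d < D \<Longrightarrow> N d \<ge> 1"
    and "\<And>d. d < D \<Longrightarrow> a d > 0"
    and "\<And>d. d < D \<Longrightarrow> c d > 0"
    and "\<And>d. d < D \<Longrightarrow> a d \<noteq> c d"
    and "(\<Sum>d<D. a d + c d) \<le> 1"
    and "\<And>d. d < D \<Longrightarrow>
           eigvals (path_mat (N d) (a d) (c d)) = {# lam d l. l \<in># mset_set {..<N d} #}"
  shows "eigvals (lattice_mat D N a c) =
           {# 1 - (\<Sum>d<D. 1 - lam d (l d)). l \<in># mset_set (\<Pi>\<^sub>E d\<in>{..<D}. {..<N d}) #} \<and>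
         (\<forall>d<D. is_left_Perron_vec (path_mat (N d) (a d) (c d))
                  (left_Perron_vec (path_mat (N d) (a d) (c d)))) \<and>
         is_left_Perron_vec (lattice_mat D N a c) (left_Perron_vec (lattice_mat D N a c)) \<and>
         left_Perron_vec (lattice_mat D N a c) =
           kron_vecs D (\<lambda>d. left_Perron_vec (path_mat (N d) (a d) (c d)))"
proof -
  let ?path = "\<lambda>d. path_mat (N d) (a d) (c d)" and ?coords = "\<lambda>i. restrict (lattice_coord N i) {..<D}"
  have le: "a d + c d \<le> 1" if "d < D" for d
  proof -
    have "a d + c d \<le> (\<Sum>d<D. a d + c d)"
      using that assms(3,4) by (intro member_le_sum) (auto intro!: add_pos_pos less_imp_le)
    thus ?thesis using assms(6) by simp
  qed
  have path: "is_left_Perron_vec (?path d) (left_Perron_vec (?path d))" if "d < D" for d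
    using path_mat_has_left_Perron_vec[of "N d" "a d" "c d"] le assms(2-4) that left_Perron_vec_eq
    by metis
  have lat: "is_left_Perron_vec (lattice_mat D N a c) (kron_vecs D (\<lambda>d. left_Perron_vec (?path d)))"
    using is_left_Perron_vec_lattice_mat[of D N a c "\<lambda>d. left_Perron_vec (?path d)"] assms(1-4,6) path
    by simp
  have "eigvals (lattice_mat D N a c) =
      {# 1 - (\<Sum>d<D. 1 - lam d (lattice_coord N i d)). i \<in># mset_set {..<num_nodes D N} #}"
    by (rule eigvals_lattice_mat_by_node) (rule assms(7))
  also have "\<dots> = image_mset (\<lambda>l. 1 - (\<Sum>d<D. 1 - lam d (l d)))
      (image_mset ?coords (mset_set {..<num_nodes D N}))"
    by (simp add: image_mset.compositionality o_def)
  also have "image_mset ?coords (mset_set {..<num_nodes D N}) = mset_set (\<Pi>\<^sub>E d\<in>{..<D}. {..<N d})"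
    using bij_betw_lattice_coords[of N D] by (simp add: bij_betw_def image_mset_mset_set)
  finally show ?thesis using path lat left_Perron_vec_eq[OF lat] by simp
qed

end
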